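(* Let $\mathcal{I}$ be an admissible ideal on $\mathbb{N}$ and let $X$ be a $T_1$ topological space. Then $X$ has a point-countable $\mathcal{I}$-$cs$-network if and only if there exist a metric space $M$ and a continuous surjective mapping $f:M\to X$ that is both $\mathcal{I}$-covering and an $s$-mapping.
   Context: $\mathbb{N}$ is the set of positive integers. An ideal $\mathcal{I}$ on $\mathbb{N}$ is a family of subsets of $\mathbb{N}$ closed under subsets and finite unions; it is admissible if $\mathbb{N}\notin\mathcal{I}$ and $\{n\}\in\mathcal{I}$ for every $n\in\mathbb{N}$. A sequence $\{x_n\}_{n\in\mathbb{N}}$ in a topological space $X$ is $\mathcal{I}$-convergent to $x\in X$ (written $x_n\xrightarrow{\mathcal{I}}x$) if $\{n\in\mathbb{N}:x_n\notin U\}\in\mathcal{I}$ for every neighborhood $U$ of $x$. A mapping $f:X\to Y$ is $\mathcal{I}$-covering if whenever $y_n\xrightarrow{\mathcal{I}}y$ in $Y$, there is a sequence $x_n\xrightarrow{\mathcal{I}}x$ in $X$ with $x\in f^{-1}(y)$ and $x_n\in f^{-1}(y_n)$ for every $n$. A mapping $f:X\to Y$ is an $s$-mapping if $f^{-1}(y)$ is a separable subset of $X$ for each $y\in Y$. A family $\mathcal{P}$ of subsets of $X$ is an $\mathcal{I}$-$cs$-network at $x\in X$ if whenever a sequence $\{x_n\}_{n\in\mathbb{N}}$ in $X$ is $\mathcal{I}$-convergent to $x$ and $U$ is open with $x\in U$, there are $I\in\mathcal{I}$ and $P\in\mathcal{P}$ with $\{x\}\cup\{x_n:n\in\mathbb{N}\setminus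 I\}\subseteq P\subseteq U$; it is an $\mathcal{I}$-$cs$-network for $X$ if it is an $\mathcal{I}$-$cs$-network at every point of $X$. A family $\mathcal{P}$ of subsets of $X$ is point-countable if each point of $X$ belongs to at most countably many members of $\mathcal{P}$. *)

theory Defs
  imports "HOL-Analysis.Analysis"
begin

abbreviation pos_nats :: "nat set" where
  "pos_nats \<equiv> {1..}"

(* F may be empty, so an ideal always contains the empty set. *)
definition ideal_on_pos :: "nat set set \<Rightarrow> bool" where
  "ideal_on_pos \<I> \<longleftrightarrow>
     \<I> \<subseteq> Pow pos_nats \<and>
     (\<forall>A\<in>\<I>. \<forall>B. B \<subseteq> A \<longrightarrow> B \<in> \<I>) \<and>
     (\<forall>F. finite F \<and> F \<subseteq> \<I> \<longrightarrow> \<Union>F \<in> \<I>)"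

definition admissible_ideal :: "nat set set \<Rightarrow> bool" where
  "admissible_ideal \<I> \<longleftrightarrow>
     ideal_on_pos \<I> \<and> pos_nats \<notin> \<I> \<and> (\<forall>n\<in>pos_nats. {n} \<in> \<I>)"

(* A sequence indexed by the positive integers is a function on nat whose value at 0 is
   irrelevant: all conditions below are restricted to indices in pos_nats. *)
definition seq_in :: "'a topology \<Rightarrow> (nat \<Rightarrow> 'a) \<Rightarrow> bool" where
  "seq_in X s \<longleftrightarrow> (\<forall>n\<in>pos_nats. s n \<in> topspace X)"

(* Neighbourhoods need not be open. *)
definition ideal_convergent ::
    "nat set set \<Rightarrow> 'a topology \<Rightarrow> (nat \<Rightarrow> 'a) \<Rightarrow> 'a \<Rightarrow> bool" where
  "ideal_convergent \<I> X s x \<longleftrightarrow>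
     seq_in X s \<and> x \<in> topspace X \<and>
     (\<forall>U. U \<subseteq> topspace X \<and> x \<in> X interior_of U \<longrightarrow> {n\<in>pos_nats. s n \<notin> U} \<in> \<I>)"

definition ideal_covering ::
    "nat set set \<Rightarrow> 'a topology \<Rightarrow> 'b topology \<Rightarrow> ('a \<Rightarrow> 'b) \<Rightarrow> bool" where
  "ideal_covering \<I> X Y f \<longleftrightarrow>
     (\<forall>t y. ideal_convergent \<I> Y t y \<longrightarrow>
        (\<exists>s x. ideal_convergent \<I> X s x \<and> f x = y \<and> (\<forall>n\<in>pos_nats. f (s n) = t n)))"

definition s_mapping :: "'a topology \<Rightarrow> 'b topology \<Rightarrow> ('a \<Rightarrow> 'b) \<Rightarrow> bool" where
  "s_mapping X Y f \<longleftrightarrow>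
     (\<forall>y\<in>topspace Y. separable_space (subtopology X {x \<in> topspace X. f x = y}))"

definition ideal_cs_network_at ::
    "nat set set \<Rightarrow> 'a topology \<Rightarrow> 'a set set \<Rightarrow> 'a \<Rightarrow> bool" where
  "ideal_cs_network_at \<I> X \<P> x \<longleftrightarrow>
     (\<forall>s U. ideal_convergent \<I> X s x \<and> openin X U \<and> x \<in> U \<longrightarrow>
        (\<exists>I\<in>\<I>. \<exists>P\<in>\<P>. {x} \<union> s ` (pos_nats - I) \<subseteq> P \<and> P \<subseteq> U))"

definition ideal_cs_network ::
    "nat set set \<Rightarrow> 'a topology \<Rightarrow> 'a set set \<Rightarrow> bool" where
  "ideal_cs_network \<I> X \<P> \<longleftrightarrow>
     \<P> \<subseteq> Pow (topspace X) \<and> (\<forall>x\<in>topspace X. ideal_cs_network_at \<I> X \<P> x)"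

definition point_countable :: "'a topology \<Rightarrow> 'a set set \<Rightarrow> bool" where
  "point_countable X \<P> \<longleftrightarrow> (\<forall>x\<in>topspace X. countable {P\<in>\<P>. x \<in> P})"

(* Existence of a metric space cannot range over all types.  Here the points of M are drawn
   from an arbitrary type 'b, which is a parameter of the notion, passed as TYPE('b). *)
definition metric_ideal_covering_s_image ::
    "'b itself \<Rightarrow> nat set set \<Rightarrow> 'a topology \<Rightarrow> bool" where
  "metric_ideal_covering_s_image T \<I> X \<longleftrightarrow>
     (\<exists>(M :: 'b metric) f.
        continuous_map (mtopology_of M) X f \<and> f ` mspace M = topspace X \<and>
        ideal_covering \<I> (mtopology_of M) X f \<and> s_mapping (mtopology_of M) X f)"

end

theory Submission
  imports Defs
begin

text \<open>
  A metric space has a point-countable base, and its image under a continuous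
  \<open>\<I>\<close>-covering \<open>s\<close>-mapping is an \<open>\<I>\<close>-\<open>cs\<close>-network; it stays point-countable because every open
  set meeting a fibre meets a countable dense subset of that fibre.

  Conversely, let \<open>\<P>\<close> be a point-countable \<open>\<I>\<close>-\<open>cs\<close>-network. The sequences in \<open>\<P>\<close> that form a
  network at some point (unique, since the space is \<open>T\<^sub>1\<close>) are a subspace of a countable power of
  a discrete space, and sending a sequence to its point is the required mapping. To lift
  \<open>t\<^sub>n \<rightarrow> y\<close>, enumerate as \<open>a\<close> the members of \<open>\<P>\<close> that contain \<open>y\<close> and \<open>\<I>\<close>-almost all \<open>t\<^sub>n\<close>; the
  lift of \<open>t\<^sub>n\<close> follows \<open>a\<close> as long as its members contain \<open>t\<^sub>n\<close> and then enumerates all members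
  containing \<open>t\<^sub>n\<close>. If all members of \<open>a\<close> contain \<open>t\<^sub>n\<close>, then \<open>t\<^sub>n = y\<close> by \<open>T\<^sub>1\<close>, and \<open>a\<close> itself is
  a lift.
\<close>

section \<open>Point-countable bases of metric spaces\<close>

lemma (in Metric_space) disjoint_open_families_cover:
  assumes "e > 0"
  obtains \<D> :: "nat \<Rightarrow> 'a set set"
  where "\<And>j D. D \<in> \<D> j \<Longrightarrow> openin mtopology D \<and> (\<exists>x. D \<subseteq> mball x e)"
    and "\<And>j. disjoint (\<D> j)"
    and "M \<subseteq> \<Union>(\<Union>(range \<D>))"
proof -
  \<comment> \<open>M. E. Rudin's construction from her proof of Stone's theorem: each centre \<open>c\<close> is assigned to
    the first ball containing it in a well-order, and is used at scale \<open>j\<close> only if it lies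
    \<open>3 / 2 ^ j\<close> deep in that ball, so centres assigned to different balls are far apart.\<close>
  obtain r :: "'a rel" where r: "well_order_on UNIV r"
    using well_order_on by blast
  have wf: "wf (r - Id)" and tot: "\<And>x y. x \<noteq> y \<Longrightarrow> (x, y) \<in> r \<or> (y, x) \<in> r"
    using r by (auto simp: well_order_on_def linear_order_on_def total_on_def)
  define first where
    "first x c \<longleftrightarrow> c \<in> mball x e \<and> (\<forall>y. (y, x) \<in> r - Id \<longrightarrow> c \<notin> mball y e)" for x c
  define K where
    "K j x = {c. first x c \<and> mball c (3 / 2 ^ j) \<subseteq> mball x e}" for j :: nat and x
  define D where "D j x = (\<Union>c\<in>K j x. mball c (1 / 2 ^ j))" for j x
  have D_sub: "D j x \<subseteq> mball x e" for j x
  proof -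
    have "mball c (1 / 2 ^ j) \<subseteq> mball x e" if "c \<in> K j x" for c
    proof -
      have "mball c (1 / 2 ^ j) \<subseteq> mball c (3 / 2 ^ j)"
        by (intro mball_subset_concentric divide_right_mono) auto
      also have "\<dots> \<subseteq> mball x e" using that by (simp add: K_def)
      finally show ?thesis .
    qed
    then show ?thesis
      unfolding D_def by (rule UN_least)
  qed
  have far: False
    if c: "c \<in> K j x" and c': "c' \<in> K j x'" and less: "(x, x') \<in> r - Id"
      and z: "z \<in> mball c (1 / 2 ^ j)" "z \<in> mball c' (1 / 2 ^ j)" for j x x' c c' z
  proof -
    \<comment> \<open>\<open>c'\<close> misses the earlier ball around \<open>x\<close>, in which
      \<open>c\<close> lies \<open>3 / 2 ^ j\<close> deep, so the centres are at least that far
      apart; a common point \<open>z\<close> would put them within two radii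
      \<open>1 / 2 ^ j\<close>.\<close>
    have "c' \<notin> mball x e"
      using c' less by (auto simp: K_def first_def)
    then have "c' \<notin> mball c (3 / 2 ^ j)"
      using c by (auto simp: K_def)
    moreover have "d c c' \<le> d c z + d c' z"
      using z triangle'' by (metis commute in_mball triangle)
    moreover have "d c z + d c' z < 1 / 2 ^ j + 1 / 2 ^ j"
      using z by (intro add_strict_mono) auto
    moreover have "1 / 2 ^ j + 1 / 2 ^ j < (3::real) / 2 ^ j"
      by (simp add: field_simps)
    ultimately show False
      using z by auto
  qed
  show thesis
  proof
    show "openin mtopology A \<and> (\<exists>x. A \<subseteq> mball x e)" if A: "A \<in> range (D j)" for j A
    proof -
      obtain x where "A = D j x" using A by blast
      moreover have "openin mtopology (D j x)"
        by (auto simp: D_def)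
      ultimately show ?thesis using D_sub by blast
    qed
    have "x = x'" if "z \<in> D j x" "z \<in> D j x'" for j x x' z
      using that far tot[of x x'] by (auto simp: D_def) blast
    then show "disjoint (range (D j))" for j
      by (auto simp: disjoint_def; blast)
    show "M \<subseteq> \<Union>(\<Union>j. range (D j))"
    proof
      fix c assume c: "c \<in> M"
      then have "c \<in> {x. c \<in> mball x e}" using assms by simp
      then obtain x where "x \<in> {x. c \<in> mball x e}"
        and "\<And>y. (y, x) \<in> r - Id \<Longrightarrow> y \<notin> {x. c \<in> mball x e}"
        by (rule wfE_min[OF wf]) blast
      then have x: "first x c"
        unfolding first_def by blast
      then have "openin mtopology (mball x e)" "c \<in> mball x e"
        by (auto simp: first_def)
      then obtain s where s: "s > 0" "mball c s \<subseteq> mball x e"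
        by (auto simp: openin_mtopology)
      obtain j where "(1 / 2) ^ j < s / 3"
        using s(1) real_arch_pow_inv[of "s / 3" "1 / 2"] by auto
      then have "3 / 2 ^ j \<le> s"
        by (simp add: field_simps)
      then have "mball c (3 / 2 ^ j) \<subseteq> mball x e"
        using s(2) mball_subset_concentric by blast
      then have "c \<in> K j x" using x by (simp add: K_def)
      then have "c \<in> D j x"
        using c by (auto simp: D_def intro!: bexI[of _ c])
      then show "c \<in> \<Union>(\<Union>j. range (D j))" by blast
    qed
  qed
qed

text \<open>Unite the covers at all scales \<open>(1/2)^n\<close>. Each of the countably many
  disjoint families contributes at most one set containing a given point.\<close>

lemma (in Metric_space) point_countable_base:
  obtains \<B> :: "'a set set"
  where "\<And>B. B \<in> \<B> \<Longrightarrow> openin mtopology B"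
    and "\<And>x. countable {B \<in> \<B>. x \<in> B}"
    and "\<And>U x. openin mtopology U \<Longrightarrow> x \<in> U \<Longrightarrow> \<exists>B\<in>\<B>. x \<in> B \<and> B \<subseteq> U"
proof -
  have "\<exists>\<D> :: nat \<Rightarrow> 'a set set.
          (\<forall>j. \<forall>D\<in>\<D> j. openin mtopology D \<and> (\<exists>x. D \<subseteq> mball x ((1/2)^n))) \<and>
          (\<forall>j. disjoint (\<D> j)) \<and> M \<subseteq> \<Union>(\<Union>(range \<D>))" for n :: nat
    by (rule disjoint_open_families_cover[of "(1/2)^n"]) (simp, blast)
  then obtain \<D> :: "nat \<Rightarrow> nat \<Rightarrow> 'a set set" where
    op: "\<And>n j D. D \<in> \<D> n j \<Longrightarrow> openin mtopology D"
    and small: "\<And>n j D. D \<in> \<D> n j \<Longrightarrow> \<exists>x. D \<subseteq> mball x ((1/2)^n)"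
    and dis: "\<And>n j. disjoint (\<D> n j)"
    and cov: "\<And>n. M \<subseteq> \<Union>(\<Union>(range (\<D> n)))"
    by metis
  show thesis
  proof
    show "openin mtopology B" if "B \<in> (\<Union>n j. \<D> n j)" for B
      using that op by blast
    show "countable {B \<in> \<Union>n j. \<D> n j. x \<in> B}" for x
    proof -
      have "countable {B \<in> \<D> n j. x \<in> B}" for n j
      proof (cases "\<exists>B\<in>\<D> n j. x \<in> B")
        case True
        then obtain B where "B \<in> \<D> n j" "x \<in> B" by blast
        then have "{B \<in> \<D> n j. x \<in> B} \<subseteq> {B}"
          using dis[of n j] by (auto simp: disjoint_def)
        then show ?thesis by (meson countable_empty countable_insert countable_subset)
      next
        case False
        then have "{B \<in> \<D> n j. x \<in> B} = {}" by blast
        then show ?thesis by (metis countable_empty)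
      qed
      then have "countable (\<Union>n j. {B \<in> \<D> n j. x \<in> B})"
        by blast
      moreover have "{B \<in> \<Union>n j. \<D> n j. x \<in> B} = (\<Union>n j. {B \<in> \<D> n j. x \<in> B})"
        by blast
      ultimately show ?thesis by simp
    qed
    show "\<exists>B\<in>\<Union>n j. \<D> n j. x \<in> B \<and> B \<subseteq> U" if U: "openin mtopology U" and x: "x \<in> U" for U x
    proof -
      obtain s where s: "s > 0" "mball x s \<subseteq> U" and xM: "x \<in> M"
        using U x unfolding openin_mtopology by (meson subsetD)
      \<comment> \<open>A set inside a ball of radius \<open>(1/2)^n\<close> has any two points less
        than \<open>s\<close> apart, so if it contains \<open>x\<close> it lies in
        \<open>mball x s\<close>.\<close>
      obtain n where n: "(1/2)^n < s / 2"
        using s(1) real_arch_pow_inv[of "s / 2" "1/2"] by auto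
      obtain j B where B: "B \<in> \<D> n j" "x \<in> B"
        using cov[of n] xM by blast
      then obtain c where c: "B \<subseteq> mball c ((1/2)^n)"
        using small by blast
      have "B \<subseteq> mball x s"
      proof
        fix z assume "z \<in> B"
        then have z: "z \<in> mball c ((1/2)^n)" and x': "x \<in> mball c ((1/2)^n)"
          using c B by auto
        then have "d x z \<le> d c x + d c z"
          by (metis commute in_mball triangle)
        with z x' n show "z \<in> mball x s" by auto
      qed
      with s B show ?thesis by blast
    qed
  qed
qed

section \<open>Ideals and convergence tested on open sets\<close>

lemma ideal_on_pos_subset: "ideal_on_pos \<I> \<Longrightarrow> A \<in> \<I> \<Longrightarrow> B \<subseteq> A \<Longrightarrow> B \<in> \<I>"
  by (auto simp: ideal_on_pos_def)

lemma ideal_on_pos_Union: "ideal_on_pos \<I> \<Longrightarrow> finite F \<Longrightarrow> F \<subseteq> \<I> \<Longrightarrow> \<Union>F \<in> \<I>"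
  by (auto simp: ideal_on_pos_def)

lemma ideal_on_pos_empty: "ideal_on_pos \<I> \<Longrightarrow> {} \<in> \<I>"
  using ideal_on_pos_Union[of \<I> "{}"] by simp

lemma ideal_convergent_openin:
  "ideal_convergent \<I> X s x \<Longrightarrow> openin X U \<Longrightarrow> x \<in> U \<Longrightarrow> {n\<in>pos_nats. s n \<notin> U} \<in> \<I>"
  unfolding ideal_convergent_def by (metis interior_of_openin openin_subset)

lemma ideal_convergentI:
  assumes "ideal_on_pos \<I>" "seq_in X s" "x \<in> topspace X"
    and "\<And>U. openin X U \<Longrightarrow> x \<in> U \<Longrightarrow> {n\<in>pos_nats. s n \<notin> U} \<in> \<I>"
  shows "ideal_convergent \<I> X s x"
  unfolding ideal_convergent_def
proof (intro conjI allI impI)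
  fix U assume U: "U \<subseteq> topspace X \<and> x \<in> X interior_of U"
  then have "{n\<in>pos_nats. s n \<notin> X interior_of U} \<in> \<I>"
    using assms(4) by simp
  then show "{n\<in>pos_nats. s n \<notin> U} \<in> \<I>"
    using interior_of_subset[of X U] by (elim ideal_on_pos_subset[OF assms(1)]) auto
qed (use assms in auto)

section \<open>From a metric domain to a network\<close>

lemma ideal_cs_network_of_metric_image:
  fixes X :: "'a topology" and M :: "'b metric" and f :: "'b \<Rightarrow> 'a"
  assumes I: "ideal_on_pos \<I>"
    and cont: "continuous_map (mtopology_of M) X f"
    and cov: "ideal_covering \<I> (mtopology_of M) X f" and sm: "s_mapping (mtopology_of M) X f"
  shows "\<exists>\<P>. ideal_cs_network \<I> X \<P> \<and> point_countable X \<P>"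
proof -
  let ?T = "mtopology_of M"
  have T: "?T = Metric_space.mtopology (mspace M) (mdist M)"
    by (simp add: mtopology_of_def)
  obtain \<B> where op: "\<And>B. B \<in> \<B> \<Longrightarrow> openin ?T B"
    and cnt: "\<And>x. countable {B \<in> \<B>. x \<in> B}"
    and base: "\<And>U x. openin ?T U \<Longrightarrow> x \<in> U \<Longrightarrow> \<exists>B\<in>\<B>. x \<in> B \<and> B \<subseteq> U"
    by (rule Metric_space.point_countable_base
          [OF Metric_space_mspace_mdist, of M, folded T], rule that)
  have "ideal_cs_network_at \<I> X ((`) f ` \<B>) y" for y
    unfolding ideal_cs_network_at_def
  proof (intro allI impI, elim conjE)
    fix t U assume t: "ideal_convergent \<I> X t y" and U: "openin X U" "y \<in> U"
    then obtain s x where s: "ideal_convergent \<I> ?T s x" "f x = y"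
      and st: "\<And>n. n \<in> pos_nats \<Longrightarrow> f (s n) = t n"
      using cov unfolding ideal_covering_def by metis
    have "openin ?T {x \<in> topspace ?T. f x \<in> U}"
      using cont U(1) by (rule openin_continuous_map_preimage)
    moreover have "x \<in> {x \<in> topspace ?T. f x \<in> U}"
      using s U(2) by (simp add: ideal_convergent_def)
    ultimately obtain B where B: "B \<in> \<B>" "x \<in> B" "B \<subseteq> {x \<in> topspace ?T. f x \<in> U}"
      using base by meson
    have "{n\<in>pos_nats. s n \<notin> B} \<in> \<I>"
      using s(1) op[OF B(1)] B(2) by (rule ideal_convergent_openin)
    moreover have "{y} \<union> t ` (pos_nats - {n\<in>pos_nats. s n \<notin> B}) \<subseteq> f ` B"
      using s(2) B(2) st by (auto simp: image_iff) metis
    moreover have "f ` B \<subseteq> U" using B(3) by auto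
    ultimately show "\<exists>I\<in>\<I>. \<exists>P\<in>(`) f ` \<B>. {y} \<union> t ` (pos_nats - I) \<subseteq> P \<and> P \<subseteq> U"
      using B(1) by blast
  qed
  moreover have "(`) f ` \<B> \<subseteq> Pow (topspace X)"
    using continuous_map_image_subset_topspace[OF cont] openin_subset[OF op] by blast
  moreover have "point_countable X ((`) f ` \<B>)"
    unfolding point_countable_def
  proof
    fix y assume "y \<in> topspace X"
    define F where "F = {x \<in> topspace ?T. f x = y}"
    obtain C where C: "countable C" "subtopology ?T F closure_of C = topspace (subtopology ?T F)"
      using sm \<open>y \<in> topspace X\<close> by (auto simp: s_mapping_def separable_space_def F_def)
    have "{P \<in> (`) f ` \<B>. y \<in> P} \<subseteq> (`) f ` (\<Union>c\<in>C. {B \<in> \<B>. c \<in> B})"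
    proof
      fix P assume "P \<in> {P \<in> (`) f ` \<B>. y \<in> P}"
      then obtain B x where B: "B \<in> \<B>" "P = f ` B" "x \<in> B" "f x = y" by auto
      then have "openin (subtopology ?T F) (F \<inter> B)"
        using op by (simp add: openin_subtopology_Int2)
      moreover have "x \<in> F \<inter> B"
        using B op openin_subset by (fastforce simp: F_def)
      moreover from this have "x \<in> subtopology ?T F closure_of C"
        unfolding C(2) by (simp add: F_def)
      ultimately obtain c where "c \<in> C" "c \<in> F \<inter> B"
        unfolding in_closure_of by meson
      with B show "P \<in> (`) f ` (\<Union>c\<in>C. {B \<in> \<B>. c \<in> B})" by blast
    qed
    then show "countable {P \<in> (`) f ` \<B>. y \<in> P}"
      by (rule countable_subset) (use C(1) cnt in auto)
  qed
  ultimately show ?thesis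
    unfolding ideal_cs_network_def by blast
qed

section \<open>Sequences over a discrete space\<close>

text \<open>The generalized Baire space: sets of sequences with a common finite prefix form a
  base.\<close>

abbreviation sequence_topology :: "(nat \<Rightarrow> 'b) topology" where
  "sequence_topology \<equiv> product_topology (\<lambda>_. discrete_topology UNIV) UNIV"

lemma openin_sequence_topology_prefix:
  assumes "openin sequence_topology U" "a \<in> U"
  obtains k where "{b. \<forall>i<k. b i = a i} \<subseteq> U"
proof -
  obtain V where V: "finite {i. V i \<noteq> UNIV}" "a \<in> Pi\<^sub>E UNIV V" "Pi\<^sub>E UNIV V \<subseteq> U"
    using assms unfolding openin_product_topology_alt by auto
  then obtain k where k: "\<And>i. V i \<noteq> UNIV \<Longrightarrow> i < k"
    using finite_nat_set_iff_bounded by auto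
  have "{b. \<forall>i<k. b i = a i} \<subseteq> Pi\<^sub>E UNIV V"
    using k V(2) by (auto simp: PiE_iff) (metis UNIV_I)
  then show thesis
    using V(3) that by (meson subset_trans)
qed

lemma openin_sequence_topology_coordinate: "openin sequence_topology {b. b i = c}"
  using openin_continuous_map_preimage
    [OF continuous_map_product_projection[of i UNIV], of "\<lambda>_. discrete_topology UNIV" "{c}"]
  by simp

lemma openin_sequence_topology_cylinder: "openin sequence_topology {b. \<forall>i<k. b i = c i}"
proof -
  have eq: "{b. \<forall>i<k. b i = c i} =
      topspace sequence_topology \<inter> (\<Inter>i\<in>{..<k}. {b. b i = c i})"
    by auto
  show ?thesis
    unfolding eq using openin_topspace[of sequence_topology]
    \<comment> \<open>For \<open>k = 0\<close> the intersection runs over an empty family and only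
      the whole space remains.\<close>
    by (cases "k = 0")
      (auto simp del: openin_topspace intro!: openin_Inter openin_sequence_topology_coordinate)
qed

lemma metrizable_sequence_topology: "metrizable_space sequence_topology"
  by (simp add: metrizable_space_product_topology)

text \<open>There are only countably many finite lists over \<open>C\<close>, and their cylinders
  form a base of the subspace. Applied to a fibre, with \<open>C\<close> the members of the network
  through its point.\<close>

lemma separable_sequence_subspace:
  assumes "countable C" "\<And>a i. a \<in> F \<Longrightarrow> a i \<in> C"
  shows "separable_space (subtopology sequence_topology F)"
proof (rule second_countable_imp_separable_space)
  let ?N = "\<lambda>l. F \<inter> {b. \<forall>i<length l. b i = l ! i}"
  show "second_countable (subtopology sequence_topology F)"
    unfolding second_countable_def
  proof (intro exI conjI ballI allI impI)
    show "countable (?N ` lists C)"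
      using assms(1) by simp
    show "openin (subtopology sequence_topology F) V" if "V \<in> ?N ` lists C" for V
      using that by (auto intro!: openin_subtopology_Int2 openin_sequence_topology_cylinder)
    fix U a assume "openin (subtopology sequence_topology F) U \<and> a \<in> U"
    then obtain W where W: "openin sequence_topology W" "U = W \<inter> F" "a \<in> W" "a \<in> F"
      by (auto simp: openin_subtopology)
    then obtain k where k: "{b. \<forall>i<k. b i = a i} \<subseteq> W"
      using openin_sequence_topology_prefix by blast
    have "?N (map a [0..<k]) \<subseteq> U" "a \<in> ?N (map a [0..<k])"
      using k W by auto
    moreover have "map a [0..<k] \<in> lists C"
      using assms(2) W(4) by auto
    ultimately show "\<exists>V\<in>?N ` lists C. a \<in> V \<and> V \<subseteq> U"
      by (intro bexI[of _ "?N (map a [0..<k])"] conjI imageI)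
  qed
qed

section \<open>Countable networks at a point, and the mapping they define\<close>

text \<open>A sequence rather than a family, so that it is a point of the sequence space;
  repetitions are allowed.\<close>

definition network_at :: "'a topology \<Rightarrow> (nat \<Rightarrow> 'a set) \<Rightarrow> 'a \<Rightarrow> bool" where
  "network_at X a x \<longleftrightarrow>
     x \<in> topspace X \<and> (\<forall>i. x \<in> a i) \<and> (\<forall>U. openin X U \<and> x \<in> U \<longrightarrow> (\<exists>i. a i \<subseteq> U))"

text \<open>By \<open>T\<^sub>1\<close> some open set around \<open>x\<close> misses
  \<open>y\<close>, yet it contains an \<open>a i\<close>. This makes the mapping well defined and
  settles the lifting of terms that lie in every \<open>a i\<close>.\<close>

lemma network_at_unique:
  assumes "t1_space X" "network_at X a x" "y \<in> topspace X" "\<And>i. y \<in> a i"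
  shows "y = x"
proof (rule ccontr)
  assume "y \<noteq> x"
  then obtain U where "openin X U" "x \<in> U" "y \<notin> U"
    using assms(1-3) unfolding t1_space_def network_at_def by metis
  then show False
    using assms(2,4) unfolding network_at_def by blast
qed

lemma countable_network_at_enumeration:
  assumes "countable \<Q>" "x \<in> topspace X" "\<And>P. P \<in> \<Q> \<Longrightarrow> x \<in> P"
    and net: "\<And>U. openin X U \<Longrightarrow> x \<in> U \<Longrightarrow> \<exists>P\<in>\<Q>. P \<subseteq> U"
  shows "range (from_nat_into \<Q>) \<subseteq> \<Q>" "network_at X (from_nat_into \<Q>) x"
proof -
  \<comment> \<open>Only a nonempty set is the range of its enumeration
    \<open>from_nat_into\<close>.\<close>
  have "\<Q> \<noteq> {}" using net[OF openin_topspace assms(2)] by blast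
  then have *: "range (from_nat_into \<Q>) = \<Q>"
    using assms(1) by (rule range_from_nat_into)
  then show "range (from_nat_into \<Q>) \<subseteq> \<Q>" by simp
  show "network_at X (from_nat_into \<Q>) x"
    unfolding network_at_def
  proof (intro conjI allI impI)
    show "x \<in> from_nat_into \<Q> i" for i
      using assms(3) * by blast
    show "\<exists>i. from_nat_into \<Q> i \<subseteq> U" if "openin X U \<and> x \<in> U" for U
      using net[of U] that * by (metis rangeE)
  qed (rule assms(2))
qed

lemma metric_image_of_ideal_cs_network:
  fixes X :: "'a topology"
  assumes I: "ideal_on_pos \<I>" and t1: "t1_space X"
    and net: "ideal_cs_network \<I> X \<P>" and pc: "point_countable X \<P>"
  shows "metric_ideal_covering_s_image TYPE(nat \<Rightarrow> 'a set) \<I> X"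
proof -
  define S where "S = {a. range a \<subseteq> \<P> \<and> (\<exists>x. network_at X a x)}"
  define f where "f a = (THE x. network_at X a x)" for a
  have f_eq: "f a = x" if "network_at X a x" for a x
    unfolding f_def using that network_at_unique[OF t1 that]
    by (intro the_equality) (auto simp: network_at_def)
  have net_f: "network_at X a (f a)" if "a \<in> S" for a
    using that f_eq unfolding S_def by auto
  let ?T = "subtopology sequence_topology S"
  have top: "topspace ?T = S" by simp
  have "metrizable_space ?T"
    by (simp add: metrizable_space_subtopology metrizable_sequence_topology)
  \<comment> \<open>Any compatible metric will do: all that follows depends on the topology
    alone.\<close>
  then obtain M :: "(nat \<Rightarrow> 'a set) metric" where M: "mtopology_of M = ?T"
    unfolding metrizable_space_def by (metis Metric_space.mtopology_of)
  have mspace: "mspace M = S"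
    using M top by (metis topspace_mtopology_of)

  define \<Q> where "\<Q> x = {P \<in> \<P>. x \<in> P}" for x
  have \<Q>_countable: "countable (\<Q> x)" if "x \<in> topspace X" for x
    using pc that by (simp add: point_countable_def \<Q>_def)
  define good where
    "good t y = {P \<in> \<Q> y. {n\<in>pos_nats. t n \<notin> P} \<in> \<I>}" for t y
  have good_network: "\<exists>P\<in>good t y. P \<subseteq> U"
    if t: "ideal_convergent \<I> X t y" and U: "openin X U" "y \<in> U" for t y U
  proof -
    have "y \<in> topspace X" using t by (simp add: ideal_convergent_def)
    then obtain J P where P: "J \<in> \<I>" "P \<in> \<P>" "{y} \<union> t ` (pos_nats - J) \<subseteq> P" "P \<subseteq> U"
      using net t U unfolding ideal_cs_network_def ideal_cs_network_at_def by meson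
    then have "{n\<in>pos_nats. t n \<notin> P} \<subseteq> J" by auto
    then have "{n\<in>pos_nats. t n \<notin> P} \<in> \<I>"
      using P(1) ideal_on_pos_subset[OF I] by blast
    with P show ?thesis by (auto simp: good_def \<Q>_def)
  qed
  define e where "e x = from_nat_into (\<Q> x)" for x
  have e: "range (e x) \<subseteq> \<Q> x" "network_at X (e x) x" if x: "x \<in> topspace X" for x
  proof -
    \<comment> \<open>Applied to a constant sequence, the network property says that the members
      containing \<open>x\<close> form a network at \<open>x\<close>.\<close>
    have "ideal_convergent \<I> X (\<lambda>_. x) x"
      by (rule ideal_convergentI[OF I]) (use x in \<open>auto simp: seq_in_def ideal_on_pos_empty[OF I]\<close>)
    then have "\<exists>P\<in>\<Q> x. P \<subseteq> U" if "openin X U" "x \<in> U" for U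
      using good_network[of "\<lambda>_. x" x U] that by (auto simp: good_def)
    then show "range (e x) \<subseteq> \<Q> x" "network_at X (e x) x"
      unfolding e_def using countable_network_at_enumeration[OF \<Q>_countable[OF x] x]
      by (auto simp: \<Q>_def)
  qed

  have cont: "continuous_map ?T X f"
    unfolding continuous_map_def top
  proof (intro conjI allI impI)
    show "f \<in> S \<rightarrow> topspace X"
      using net_f by (auto simp: network_at_def)
    fix U assume U: "openin X U"
    show "openin ?T {a \<in> S. f a \<in> U}"
    proof (subst openin_subopen, intro ballI)
      fix a assume a: "a \<in> {a \<in> S. f a \<in> U}"
      then obtain i where i: "a i \<subseteq> U"
        using net_f[of a] U unfolding network_at_def by auto
      \<comment> \<open>Fixing one coordinate is enough: a sequence \<open>b\<close> in
        \<open>S\<close> with \<open>b i = a i\<close> has \<open>f b\<close> in \<open>b i\<close>,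
        hence in \<open>U\<close>.\<close>
      have "openin ?T (S \<inter> {b. b i = a i})"
        by (intro openin_subtopology_Int2 openin_sequence_topology_coordinate)
      moreover have "S \<inter> {b. b i = a i} \<subseteq> {a \<in> S. f a \<in> U}"
        using net_f i unfolding network_at_def by blast
      ultimately show "\<exists>T. openin ?T T \<and> a \<in> T \<and> T \<subseteq> {a \<in> S. f a \<in> U}"
        using a by blast
    qed
  qed

  have surj: "f ` S = topspace X"
  proof
    show "f ` S \<subseteq> topspace X" using net_f by (auto simp: network_at_def)
    show "topspace X \<subseteq> f ` S"
    proof
      fix x assume x: "x \<in> topspace X"
      then have "e x \<in> S" using e[OF x] by (auto simp: S_def \<Q>_def)
      then show "x \<in> f ` S" using f_eq[OF e(2)[OF x]] by (metis imageI)
    qed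
  qed

  have smap: "s_mapping ?T X f"
    unfolding s_mapping_def
  proof
    fix y assume y: "y \<in> topspace X"
    have "separable_space (subtopology sequence_topology {a \<in> S. f a = y})"
      using \<Q>_countable[OF y]
    proof (rule separable_sequence_subspace)
      show "a i \<in> \<Q> y" if "a \<in> {a \<in> S. f a = y}" for a i
        using that net_f[of a] by (auto simp: S_def \<Q>_def network_at_def)
    qed
    moreover have "subtopology ?T {a \<in> topspace ?T. f a = y} =
        subtopology sequence_topology {a \<in> S. f a = y}"
      unfolding top subtopology_subtopology by (rule arg_cong[of _ _ "subtopology _"]) auto
    ultimately show "separable_space (subtopology ?T {a \<in> topspace ?T. f a = y})"
      by simp
  qed

  have covering: "ideal_covering \<I> ?T X f"
    unfolding ideal_covering_def
  proof (intro allI impI)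
    fix t y assume t: "ideal_convergent \<I> X t y"
    then have y: "y \<in> topspace X" and tX: "\<And>n. n \<in> pos_nats \<Longrightarrow> t n \<in> topspace X"
      by (auto simp: ideal_convergent_def seq_in_def)
    define a where "a = from_nat_into (good t y)"
    have a: "range a \<subseteq> good t y" "network_at X a y"
    proof -
      have "countable (good t y)"
        by (rule countable_subset[OF _ \<Q>_countable[OF y]]) (auto simp: good_def)
      moreover have "y \<in> P" if "P \<in> good t y" for P
        using that by (simp add: good_def \<Q>_def)
      ultimately show "range a \<subseteq> good t y" "network_at X a y"
        unfolding a_def
        using countable_network_at_enumeration[OF _ y _ good_network[OF t]] by blast+
    qed
    then have aS: "a \<in> S" by (auto simp: S_def good_def \<Q>_def)
    define k where "k n = (LEAST k. t n \<notin> a k)" for n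
    \<comment> \<open>The prefix, up to the first failure \<open>k n\<close>, gives convergence to
      \<open>a\<close>; subtracting \<open>k n\<close> lists \<open>e (t n)\<close> from its start,
      so the tail alone shrinks to \<open>t n\<close>.\<close>
    define s where "s n = (if \<forall>i. t n \<in> a i then a
        else (\<lambda>i. if i < k n then a i else e (t n) (i - k n)))" for n
    have s: "range (s n) \<subseteq> \<P> \<and> network_at X (s n) (t n)" if n: "n \<in> pos_nats" for n
    proof (cases "\<forall>i. t n \<in> a i")
      case True
      then have "t n = y" using network_at_unique[OF t1 a(2) tX[OF n]] by blast
      with True a aS show ?thesis by (auto simp: s_def S_def)
    next
      case False
      have below: "t n \<in> a i" if "i < k n" for i
        using that not_less_Least unfolding k_def by blast
      have shift: "s n (i + k n) = e (t n) i" for i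
        using False by (auto simp: s_def)
      have "s n i \<in> \<Q> (t n)" for i
        using False a(1) e(1)[OF tX[OF n]] below by (auto simp: s_def good_def \<Q>_def)
      moreover have "\<exists>i. s n i \<subseteq> U" if "openin X U" "t n \<in> U" for U
        using e(2)[OF tX[OF n]] that shift unfolding network_at_def by metis
      ultimately show ?thesis
        using tX[OF n] by (auto simp: network_at_def \<Q>_def)
    qed
    \<comment> \<open>Hence \<open>s n\<close> can leave a cylinder of length \<open>m\<close>
      around \<open>a\<close> only if \<open>t n\<close> misses one of the first \<open>m\<close>
      sets of \<open>a\<close>; this confines the exceptional indices to a finite union of sets in
      the ideal.\<close>
    have agree: "s n i = a i" if "\<forall>j\<le>i. t n \<in> a j" for n i
    proof (cases "\<forall>i. t n \<in> a i")
      case False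
      then have "t n \<notin> a (k n)" unfolding k_def by (metis LeastI)
      then have "i < k n" using that by (meson not_le)
      then show ?thesis by (simp add: s_def)
    qed (simp add: s_def)
    have "ideal_convergent \<I> ?T s a"
    proof (rule ideal_convergentI[OF I])
      show "seq_in ?T s" using s by (auto simp: seq_in_def S_def)
      show "a \<in> topspace ?T" using aS by simp
      fix U assume U: "openin ?T U" "a \<in> U"
      then obtain W where W: "openin sequence_topology W" "U = W \<inter> S" "a \<in> W"
        by (auto simp: openin_subtopology)
      then obtain m where m: "{b. \<forall>i<m. b i = a i} \<subseteq> W"
        using openin_sequence_topology_prefix by blast
      have "(\<Union>i<m. {n\<in>pos_nats. t n \<notin> a i}) \<in> \<I>"
        using a(1) by (intro ideal_on_pos_Union[OF I]) (auto simp: good_def)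
      moreover have "{n\<in>pos_nats. s n \<notin> U} \<subseteq> (\<Union>i<m. {n\<in>pos_nats. t n \<notin> a i})"
      proof
        fix n assume n: "n \<in> {n\<in>pos_nats. s n \<notin> U}"
        then have "s n \<in> S" using s by (auto simp: S_def)
        then have "s n \<notin> {b. \<forall>i<m. b i = a i}" using n W(2) m by blast
        then obtain i where "i < m" "s n i \<noteq> a i" by blast
        then obtain j where "j \<le> i" "t n \<notin> a j" using agree[of i n] by blast
        with n \<open>i < m\<close> show "n \<in> (\<Union>i<m. {n\<in>pos_nats. t n \<notin> a i})" by auto
      qed
      ultimately show "{n\<in>pos_nats. s n \<notin> U} \<in> \<I>"
        by (rule ideal_on_pos_subset[OF I])
    qed
    moreover have "f a = y" "\<forall>n\<in>pos_nats. f (s n) = t n"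
      using f_eq a(2) s by auto
    ultimately show "\<exists>s x. ideal_convergent \<I> ?T s x \<and> f x = y \<and> (\<forall>n\<in>pos_nats. f (s n) = t n)"
      by blast
  qed
  show ?thesis
    unfolding metric_ideal_covering_s_image_def
    using cont surj covering smap
    by (intro exI[of _ M] exI[of _ f]) (simp add: M mspace)
qed

(* The type nat => 'a set is large enough for the existence direction; the second conjunct
   gives the converse for metric spaces over an arbitrary type 'b. *)
theorem corollary3p6:
  fixes \<I> :: "nat set set" and X :: "'a topology"
  assumes "admissible_ideal \<I>" and "t1_space X"
  shows "((\<exists>\<P>. ideal_cs_network \<I> X \<P> \<and> point_countable X \<P>) \<longleftrightarrow>
            metric_ideal_covering_s_image TYPE(nat \<Rightarrow> 'a set) \<I> X) \<and>
         (metric_ideal_covering_s_image TYPE('b) \<I> X \<longrightarrow>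
            (\<exists>\<P>. ideal_cs_network \<I> X \<P> \<and> point_countable X \<P>))"
proof -
  have I: "ideal_on_pos \<I>"
    using assms(1) by (simp add: admissible_ideal_def)
  \<comment> \<open>Being polymorphic in the points of the metric space, this yields both the
    converse implication and the second conjunct.\<close>
  note to_network = ideal_cs_network_of_metric_image[OF I]
  show ?thesis
  proof (intro conjI iffI impI)
    assume "\<exists>\<P>. ideal_cs_network \<I> X \<P> \<and> point_countable X \<P>"
    then show "metric_ideal_covering_s_image TYPE(nat \<Rightarrow> 'a set) \<I> X"
      using metric_image_of_ideal_cs_network[OF I assms(2)] by blast
  qed (unfold metric_ideal_covering_s_image_def, (elim exE conjE, rule to_network; assumption)+)
qed

end
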